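(* Let $q\in\{1,2,3,4\}$ and let $s\ge 1$ be an integer. Consider an $s$-stage explicit exponential Runge-Kutta (EERK) method with nodes $c_1,\dots,c_s$ and coefficient functions of the form $$a_{ij}(z)=\sum_{l=1}^s \lambda_{i,j,l}\,\varphi_l(c_i z)\quad (1\le i,j\le s),\qquad b_i(z)=\sum_{l=1}^s \mu_{i,l}\,\varphi_l(z)\quad (1\le i\le s),$$ where $\lambda_{i,j,l}$ and $\mu_{i,l}$ are constants, with $\lambda_{i,j,l}=0$ for $j\ge i$ (explicitness), and with $\sum_{j=1}^s a_{ij}(0)=c_i$ for $i=1,\dots,s$. Assume that the method has classical order at least $q$. If $s\le q$, then $$\sum_{i=1}^s \mu_{i,1}=1,\qquad \sum_{i=1}^s \mu_{i,l}=0\quad (l=2,\dots,s).$$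
   Context: For $l\ge 1$, $\varphi_l(z)=\int_0^1 e^{(1-\theta)z}\,\frac{\theta^{l-1}}{(l-1)!}\,d\theta$ (an entire function, so it can be evaluated at square matrices). Explicit exponential Runge-Kutta (EERK) method: for an ODE system $\dot U(t)=BU(t)+F(t,U(t))$, $U(t_0)=U_0$, with $B$ a constant square matrix, the method with stepsize $k>0$, nodes $c_i$ and coefficients $a_{ij}(z)$, $b_i(z)$ computes, with $t_n=t_0+nk$, $$K_{n,i}=e^{c_i kB}U_n+k\sum_{j=1}^{i-1}a_{ij}(kB)\,F(t_n+c_jk,K_{n,j}),\quad i=1,\dots,s,$$ $$U_{n+1}=e^{kB}U_n+k\sum_{i=1}^s b_i(kB)\,F(t_n+c_ik,K_{n,i}),$$ where $U_n$ approximates $U(t_0+nk)$. The integer $s$ is the number of stages, and the same $s$ is the upper limit of the index $l$ of the functions $\varphi_l$ used in the coefficients. Classical order at least $q$: for every fixed matrix $B$ (of any size) and every sufficiently smooth $F$, the local error of one step of the method started from the exact solution value is $O(k^{q+1})$ as $k\to 0$, where the constant in $O(\cdot)$ is allowed to depend on $B$ and $F$ (as opposed to the stiff order, where the constants must be uniform with respect to $\|B\|$). *)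

theory Defs
  imports "HOL-Analysis.Analysis" "Jordan_Normal_Form.Matrix"
begin

hide_const (open) Finite_Cartesian_Product.vec Finite_Cartesian_Product.mat
hide_type (open) Finite_Cartesian_Product.vec
no_notation Finite_Cartesian_Product.vec_nth (infixl "$" 90)

text \<open>The functions \<open>\<phi>\<^sub>l\<close>, for \<open>l \<ge> 1\<close>.\<close>

definition phi :: "nat \<Rightarrow> real \<Rightarrow> real" where
  "phi l z = integral {0..1} (\<lambda>\<theta>. exp ((1 - \<theta>) * z) * (\<theta> ^ (l - 1) / fact (l - 1)))"

text \<open>The value of \<open>f\<close> at a square matrix, for \<open>f\<close> the restriction to the real line of an entire
  function: the Taylor series of \<open>f\<close> at \<open>0\<close> is summed entry by entry. In particular
  \<open>mat_fun exp\<close> is the matrix exponential.\<close>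

definition mat_fun :: "(real \<Rightarrow> real) \<Rightarrow> real mat \<Rightarrow> real mat" where
  "mat_fun f A = mat (dim_row A) (dim_row A)
     (\<lambda>(i, j). \<Sum>n. (deriv ^^ n) f 0 / fact n * (A ^\<^sub>m n) $$ (i, j))"

text \<open>Internal stages \<open>K\<^sub>i\<close> and result of one step of size \<open>k\<close> from the value \<open>u\<close> at time \<open>t\<close>, for
  the system \<open>U' = B U + F(t, U)\<close>. Stages are numbered from \<open>1\<close>, and vectors from \<open>0\<close>.\<close>

function eerk_stage ::
  "real mat \<Rightarrow> (real \<Rightarrow> real vec \<Rightarrow> real vec) \<Rightarrow> (nat \<Rightarrow> real) \<Rightarrow> (nat \<Rightarrow> nat \<Rightarrow> real \<Rightarrow> real) \<Rightarrow>
   real \<Rightarrow> real \<Rightarrow> real vec \<Rightarrow> nat \<Rightarrow> real vec" where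
  "eerk_stage B F c a k t u i = vec (dim_row B) (\<lambda>r.
     (mat_fun exp ((c i * k) \<cdot>\<^sub>m B) *\<^sub>v u) $ r
     + k * (\<Sum>j\<in>{1..<i}. (mat_fun (a i j) (k \<cdot>\<^sub>m B)
              *\<^sub>v F (t + c j * k) (eerk_stage B F c a k t u j)) $ r))"
  by pat_completeness auto
termination
  by (relation "Wellfounded.measure (\<lambda>(B, F, c, a, k, t, u, i). i)") auto

declare eerk_stage.simps [simp del]

definition eerk_step ::
  "nat \<Rightarrow> (nat \<Rightarrow> real) \<Rightarrow> (nat \<Rightarrow> nat \<Rightarrow> real \<Rightarrow> real) \<Rightarrow> (nat \<Rightarrow> real \<Rightarrow> real) \<Rightarrow>
   real mat \<Rightarrow> (real \<Rightarrow> real vec \<Rightarrow> real vec) \<Rightarrow> real \<Rightarrow> real \<Rightarrow> real vec \<Rightarrow> real vec" where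
  "eerk_step s c a b B F k t u = vec (dim_row B) (\<lambda>r.
     (mat_fun exp (k \<cdot>\<^sub>m B) *\<^sub>v u) $ r
     + k * (\<Sum>i=1..s. (mat_fun (b i) (k \<cdot>\<^sub>m B)
              *\<^sub>v F (t + c i * k) (eerk_stage B F c a k t u i)) $ r))"

text \<open>\<open>C_class d r f\<close>: the function \<open>f\<close>, which is meant to depend only on the first \<open>d\<close> coordinates
  of its argument, is \<open>r\<close> times continuously differentiable in them. Continuity refers to the
  product topology, which for such a function is continuity on Euclidean \<open>d\<close>-space.\<close>

primrec C_class :: "nat \<Rightarrow> nat \<Rightarrow> ((nat \<Rightarrow> real) \<Rightarrow> real) \<Rightarrow> bool" where
  "C_class d 0 f \<longleftrightarrow> continuous_on UNIV f"
| "C_class d (Suc r) f \<longleftrightarrow> continuous_on UNIV f \<and>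
     (\<exists>f'. \<forall>i<d. (\<forall>x. ((\<lambda>h. f (x(i := h))) has_real_derivative f' i x) (at (x i)))
                  \<and> C_class d r (f' i))"

text \<open>The coordinates of the point \<open>(t, u)\<close> are \<open>x 0 = t\<close> and \<open>x (Suc i) = u\<^sub>i\<close>.\<close>

definition smooth_rhs :: "nat \<Rightarrow> nat \<Rightarrow> (real \<Rightarrow> real vec \<Rightarrow> real vec) \<Rightarrow> bool" where
  "smooth_rhs r m F \<longleftrightarrow>
     (\<forall>t. \<forall>u\<in>carrier_vec m. F t u \<in> carrier_vec m) \<and>
     (\<forall>i<m. C_class (Suc m) r (\<lambda>x. F (x 0) (vec m (\<lambda>j. x (Suc j))) $ i))"

definition ode_solution ::
  "nat \<Rightarrow> real mat \<Rightarrow> (real \<Rightarrow> real vec \<Rightarrow> real vec) \<Rightarrow> real \<Rightarrow> real \<Rightarrow> (real \<Rightarrow> real vec) \<Rightarrow> bool" where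
  "ode_solution m B F t0 T U \<longleftrightarrow>
     (\<forall>t\<in>{t0..T}. U t \<in> carrier_vec m \<and>
        (\<forall>i<m. ((\<lambda>\<tau>. U \<tau> $ i) has_real_derivative (B *\<^sub>v U t + F t (U t)) $ i)
                 (at t within {t0..T})))"

text \<open>Classical order at least \<open>q\<close>. The \<open>O\<close>-constant may depend on the whole problem, in particular
  on \<open>B\<close>; the required smoothness \<open>r\<close> of \<open>F\<close> may not. As \<open>t0\<close> is arbitrary, only the first step
  needs to be considered.\<close>

definition classical_order_at_least ::
  "nat \<Rightarrow> nat \<Rightarrow> (nat \<Rightarrow> real) \<Rightarrow> (nat \<Rightarrow> nat \<Rightarrow> real \<Rightarrow> real) \<Rightarrow> (nat \<Rightarrow> real \<Rightarrow> real) \<Rightarrow> bool" where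
  "classical_order_at_least q s c a b \<longleftrightarrow>
     (\<exists>r. \<forall>m B F t0 T U.
        B \<in> carrier_mat m m \<and> smooth_rhs r m F \<and> t0 < T \<and> ode_solution m B F t0 T U \<longrightarrow>
        (\<forall>i<m. (\<lambda>k. (U (t0 + k) - eerk_step s c a b B F k t0 (U t0)) $ i)
                 \<in> O[at_right 0](\<lambda>k. k ^ (q + 1))))"

definition coeff_a :: "nat \<Rightarrow> (nat \<Rightarrow> real) \<Rightarrow> (nat \<Rightarrow> nat \<Rightarrow> nat \<Rightarrow> real) \<Rightarrow>
    nat \<Rightarrow> nat \<Rightarrow> real \<Rightarrow> real" where
  "coeff_a s c lam i j z = (\<Sum>l=1..s. lam i j l * phi l (c i * z))"

definition coeff_b :: "nat \<Rightarrow> (nat \<Rightarrow> nat \<Rightarrow> real) \<Rightarrow> nat \<Rightarrow> real \<Rightarrow> real" where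
  "coeff_b s mu i z = (\<Sum>l=1..s. mu i l * phi l z)"

end

theory Submission
  imports Defs "HOL-Computational_Algebra.Polynomial"
begin

text \<open>A single linear test problem carries the information. Let \<open>B\<close> be the
  \<open>q \<times> q\<close> lower shift matrix and \<open>F\<close> the constant first unit vector \<open>e\<^sub>0\<close>. With \<open>U(0) = 0\<close> the exact
  solution is \<open>U\<^sub>r(t) = t\<^bsup>r+1\<^esup> / (r+1)!\<close>, and one step of the method yields \<open>k \<Sum>\<^sub>i b\<^sub>i(kB) e\<^sub>0\<close>. Since
  \<open>B\<^sup>r e\<^sub>0 = e\<^sub>r\<close>, component \<open>r\<close> of \<open>b\<^sub>i(kB) e\<^sub>0\<close> isolates the Taylor coefficient of \<open>b\<^sub>i\<close> of degree \<open>r\<close>,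
  so that component \<open>r\<close> of the local error is exactly a constant times \<open>k\<^bsup>r+1\<^esup>\<close>. As \<open>r + 1 \<le> q\<close>,
  order \<open>q\<close> forces that constant to vanish: the sum of the \<open>b\<^sub>i\<close> agrees with \<open>\<phi>\<^sub>1\<close> in its first \<open>q\<close>
  Taylor coefficients (lemma \<open>order_imp_taylor_coeff\<close>).

  To conclude, put \<open>P(\<theta>) = \<Sum>\<^sub>l (\<Sum>\<^sub>i \<mu>\<^sub>i\<^sub>l) \<theta>\<^bsup>l-1\<^esup> / (l-1)!\<close>. Then the sum of the \<open>b\<^sub>i(z)\<close> is the
  integral of \<open>e\<^bsup>(1-\<theta>)z\<^esup> P(\<theta>)\<close> over the unit interval, and \<open>\<phi>\<^sub>1\<close> is the same integral with \<open>1\<close>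
  in place of \<open>P\<close>. Derivatives at \<open>0\<close> are moments against powers of \<open>1 - \<theta>\<close>
  (lemma \<open>higher_deriv_exp_integral\<close>), hence \<open>P - 1\<close> is orthogonal to \<open>(1-\<theta>)\<^sup>r\<close> for all \<open>r < q\<close>,
  in particular for all \<open>r < s\<close>.
  But \<open>P - 1\<close> has degree less than \<open>s\<close>, so it is orthogonal to itself and vanishes
  (lemma \<open>poly_zero_moments_imp_zero\<close>). Comparing coefficients in \<open>P = 1\<close> gives the claim.\<close>

section \<open>Moments of polynomials on the unit interval\<close>

text \<open>Expanding \<open>p\<close> in powers of \<open>1 - x\<close> turns the integral of \<open>p\<^sup>2\<close> into a combination of the
  vanishing moments.\<close>

lemma poly_zero_moments_imp_zero:
  fixes p :: "real poly"
  assumes deg: "degree p < s"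
    and moments: "\<And>r. r < s \<Longrightarrow> integral {0..1} (\<lambda>x. (1 - x) ^ r * poly p x) = 0"
  shows "p = 0"
proof -
  define g where "g = pcompose p [:1, -1:]"
  have degg: "degree g = degree p"
    by (simp add: g_def degree_pcompose)
  have p_eq: "poly p x = (\<Sum>r\<le>degree p. coeff g r * (1 - x) ^ r)" for x
  proof -
    have "poly p x = poly g (1 - x)"
      by (simp add: g_def poly_pcompose)
    then show ?thesis
      by (simp add: poly_altdef degg)
  qed
  have "integral {0..1} (\<lambda>x. poly p x * poly p x)
      = integral {0..1} (\<lambda>x. \<Sum>r\<le>degree p. coeff g r * ((1 - x) ^ r * poly p x))"
    by (intro integral_cong, subst p_eq) (simp add: sum_distrib_right mult.assoc)
  also have "\<dots> = (\<Sum>r\<le>degree p. coeff g r * integral {0..1} (\<lambda>x. (1 - x) ^ r * poly p x))"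
    by (subst integral_sum)
      (auto intro!: integrable_continuous_real continuous_intros)
  also have "\<dots> = 0"
    using deg by (intro sum.neutral) (auto simp: moments)
  finally have "\<forall>x\<in>{0..1}. poly p x * poly p x = 0"
    by (subst (asm) integral_eq_0_iff) (auto intro!: continuous_intros)
  then have "{0..1} \<subseteq> {x. poly p x = 0}"
    by auto
  moreover have "infinite {0..1::real}"
    by simp
  ultimately show "p = 0"
    using poly_roots_finite infinite_super by blast
qed

lemma integral_power_one_minus:
  "integral {0..1} (\<lambda>x::real. (1 - x) ^ r) = 1 / real (Suc r)"
proof -
  have "((\<lambda>x::real. (1 - x) ^ r) has_integral
      (- ((1 - 1) ^ Suc r / real (Suc r)) - - ((1 - 0) ^ Suc r / real (Suc r)))) {0..1}"
    by (intro fundamental_theorem_of_calculus)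
      (auto simp: has_real_derivative_iff_has_vector_derivative[symmetric] simp del: power_Suc of_nat_Suc
        intro!: derivative_eq_intros)
  then show ?thesis
    by (auto dest: integral_unique)
qed

section \<open>Taylor coefficients of the weights\<close>

text \<open>Every differentiation under the integral sign brings down one more factor \<open>1 - \<theta>\<close>.\<close>

lemma higher_deriv_exp_integral:
  fixes p :: "real \<Rightarrow> real"
  assumes p: "continuous_on {0..1} p"
  shows "(deriv ^^ n) (\<lambda>z. integral {0..1} (\<lambda>\<theta>. exp ((1 - \<theta>) * z) * p \<theta>))
       = (\<lambda>z. integral {0..1} (\<lambda>\<theta>. (1 - \<theta>) ^ n * exp ((1 - \<theta>) * z) * p \<theta>))"
proof (induction n)
  case 0
  show ?case by simp
next
  case (Suc n)
  have cont: "continuous_on (UNIV \<times> {0..1})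
      (\<lambda>(z::real, \<theta>). (1 - \<theta>) ^ Suc n * exp ((1 - \<theta>) * z) * p \<theta>)"
    unfolding split_beta
    by (intro continuous_intros continuous_on_compose2[OF p]) auto
  have "((\<lambda>z. integral (cbox 0 1) (\<lambda>\<theta>. (1 - \<theta>) ^ n * exp ((1 - \<theta>) * z) * p \<theta>))
      has_real_derivative
        integral (cbox 0 1) (\<lambda>\<theta>. (1 - \<theta>) ^ Suc n * exp ((1 - \<theta>) * z) * p \<theta>)) (at z within UNIV)"
    for z
  proof (rule leibniz_rule_field_derivative)
    fix x t :: real
    show "((\<lambda>x. (1 - t) ^ n * exp ((1 - t) * x) * p t) has_real_derivative
        (1 - t) ^ Suc n * exp ((1 - t) * x) * p t) (at x within UNIV)"
      by (auto intro!: derivative_eq_intros)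
  qed (use cont in \<open>auto intro!: integrable_continuous_real continuous_intros p\<close>)
  then show ?case
    by (simp add: Suc.IH DERIV_imp_deriv fun_eq_iff)
qed

text \<open>The density against which \<open>e\<^bsup>(1-\<theta>)z\<^esup>\<close> is integrated to obtain the combination of
  \<open>\<phi>\<^sub>1, \<dots>, \<phi>\<^sub>s\<close> with coefficients \<open>m\<close>; the degree is one less than the index \<open>l\<close>.\<close>

definition weight_poly :: "nat \<Rightarrow> (nat \<Rightarrow> real) \<Rightarrow> real poly" where
  "weight_poly s m = (\<Sum>l=1..s. monom (m l / fact (l - 1)) (l - 1))"

lemma degree_weight_poly_less:
  assumes "s \<ge> 1"
  shows "degree (weight_poly s m) < s"
  unfolding weight_poly_def using assms
  by (intro degree_sum_less) (auto intro: le_less_trans[OF degree_monom_le])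

lemma coeff_weight_poly:
  assumes "l \<in> {1..s}"
  shows "coeff (weight_poly s m) (l - 1) = m l / fact (l - 1)"
proof -
  have "coeff (weight_poly s m) (l - 1)
      = (\<Sum>j=1..s. if j = l then m j / fact (j - 1) else 0)"
    unfolding weight_poly_def coeff_sum by (intro sum.cong) (use assms in auto)
  then show ?thesis
    using assms by simp
qed

lemma sum_weight_poly:
  "(\<Sum>i\<in>A. weight_poly s (m i)) = weight_poly s (\<lambda>l. \<Sum>i\<in>A. m i l)"
proof (rule poly_eqI)
  fix n
  show "coeff (\<Sum>i\<in>A. weight_poly s (m i)) n = coeff (weight_poly s (\<lambda>l. \<Sum>i\<in>A. m i l)) n"
    unfolding weight_poly_def coeff_sum
    by (subst sum.swap) (auto intro!: sum.cong simp: sum_divide_distrib)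
qed

lemma coeff_b_eq_exp_integral:
  "coeff_b s mu i
     = (\<lambda>z. integral {0..1} (\<lambda>\<theta>. exp ((1 - \<theta>) * z) * poly (weight_poly s (mu i)) \<theta>))"
proof
  fix z
  have "integral {0..1} (\<lambda>\<theta>. exp ((1 - \<theta>) * z) * poly (weight_poly s (mu i)) \<theta>)
      = integral {0..1}
          (\<lambda>\<theta>. \<Sum>l=1..s. mu i l * (exp ((1 - \<theta>) * z) * (\<theta> ^ (l - 1) / fact (l - 1))))"
    by (simp add: weight_poly_def poly_sum poly_monom sum_distrib_left mult_ac)
  also have "\<dots> = coeff_b s mu i z"
    unfolding coeff_b_def phi_def
    by (subst integral_sum) (auto intro!: integrable_continuous_real continuous_intros)
  finally show "coeff_b s mu i z
      = integral {0..1} (\<lambda>\<theta>. exp ((1 - \<theta>) * z) * poly (weight_poly s (mu i)) \<theta>)"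
    by simp
qed

lemma sum_higher_deriv_coeff_b:
  "(\<Sum>i\<in>A. (deriv ^^ r) (coeff_b s mu i) 0)
     = integral {0..1} (\<lambda>\<theta>. (1 - \<theta>) ^ r * poly (weight_poly s (\<lambda>l. \<Sum>i\<in>A. mu i l)) \<theta>)"
proof (cases "finite A")
  case True
  have "(\<Sum>i\<in>A. (deriv ^^ r) (coeff_b s mu i) 0)
      = (\<Sum>i\<in>A. integral {0..1} (\<lambda>\<theta>. (1 - \<theta>) ^ r * poly (weight_poly s (mu i)) \<theta>))"
    by (simp add: coeff_b_eq_exp_integral higher_deriv_exp_integral continuous_intros)
  also have "\<dots> = integral {0..1}
      (\<lambda>\<theta>. \<Sum>i\<in>A. (1 - \<theta>) ^ r * poly (weight_poly s (mu i)) \<theta>)"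
    by (subst integral_sum) (auto intro!: integrable_continuous_real continuous_intros simp: True)
  finally show ?thesis
    by (simp add: sum_weight_poly[symmetric] poly_sum sum_distrib_left)
qed (simp add: weight_poly_def)

section \<open>The nilpotent test problem\<close>

definition shift_mat :: "nat \<Rightarrow> real mat" where
  "shift_mat m = mat m m (\<lambda>(i, j). if i = Suc j then 1 else 0)"

lemma shift_mat_carrier [simp]:
  "shift_mat m \<in> carrier_mat m m" "dim_row (shift_mat m) = m" "dim_col (shift_mat m) = m"
  by (auto simp: shift_mat_def)

lemma smult_shift_mat_pow:
  assumes "i < m" "j < m"
  shows "((k \<cdot>\<^sub>m shift_mat m) ^\<^sub>m n) $$ (i, j) = (if i = j + n then k ^ n else 0)"
  using assms
proof (induction n arbitrary: j)
  case 0
  then show ?case by auto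
next
  case (Suc n)
  let ?A = "k \<cdot>\<^sub>m shift_mat m"
  have "(?A ^\<^sub>m Suc n) $$ (i, j) = (\<Sum>l<m. (?A ^\<^sub>m n) $$ (i, l) * ?A $$ (l, j))"
    using Suc.prems by (auto simp: scalar_prod_def lessThan_atLeast0 intro!: sum.cong)
  also have "\<dots> = (\<Sum>l<m. if l = Suc j then (?A ^\<^sub>m n) $$ (i, l) * k else 0)"
    using Suc.prems by (intro sum.cong) (auto simp: shift_mat_def)
  also have "\<dots> = (if Suc j < m then (?A ^\<^sub>m n) $$ (i, Suc j) * k else 0)"
    by simp
  also have "\<dots> = (if i = j + Suc n then k ^ Suc n else 0)"
    using Suc by auto
  finally show ?case .
qed

text \<open>The Taylor series of \<open>f\<close> at a nilpotent matrix is a finite sum, and distinct powers of the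
  shift move the first unit vector to distinct basis vectors, so each entry of the first column
  sees one term only.\<close>

lemma mat_fun_smult_shift_mat:
  assumes "i < m"
  shows "mat_fun f (k \<cdot>\<^sub>m shift_mat m) $$ (i, 0) = (deriv ^^ i) f 0 / fact i * k ^ i"
proof -
  have "mat_fun f (k \<cdot>\<^sub>m shift_mat m) $$ (i, 0)
      = (\<Sum>n. (deriv ^^ n) f 0 / fact n * ((k \<cdot>\<^sub>m shift_mat m) ^\<^sub>m n) $$ (i, 0))"
    using assms by (simp add: mat_fun_def)
  also have "\<dots> = (\<Sum>n. if n = i then (deriv ^^ n) f 0 / fact n * k ^ n else 0)"
    using assms by (intro suminf_cong) (auto simp: smult_shift_mat_pow)
  also have "\<dots> = (deriv ^^ i) f 0 / fact i * k ^ i"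
    by (subst suminf_finite[of "{i}"]) auto
  finally show ?thesis .
qed

lemma C_class_const: "C_class d r (\<lambda>x. a)"
proof (induction r arbitrary: a)
  case (Suc r)
  have "\<exists>f'. \<forall>i<d. (\<forall>x::nat \<Rightarrow> real. ((\<lambda>h. a) has_real_derivative f' i x) (at (x i)))
                  \<and> C_class d r (f' i)"
    by (rule exI[of _ "\<lambda>i x. 0"]) (auto simp: Suc.IH)
  then show ?case by simp
qed simp

lemma smooth_rhs_const:
  assumes "v \<in> carrier_vec m"
  shows "smooth_rhs r m (\<lambda>t u. v)"
  using assms by (simp add: smooth_rhs_def C_class_const)

definition shift_solution :: "nat \<Rightarrow> real \<Rightarrow> real vec" where
  "shift_solution m t = vec m (\<lambda>i. t ^ Suc i / fact (Suc i))"

lemma shift_solution_zero: "shift_solution m 0 = 0\<^sub>v m"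
  by (auto simp: shift_solution_def)

text \<open>Each component is the derivative of the next one, and the constant forcing starts the chain
  with \<open>U\<^sub>0' = 1\<close>.\<close>

lemma ode_solution_shift:
  "ode_solution m (shift_mat m) (\<lambda>t u. unit_vec m 0) t0 T (shift_solution m)"
  unfolding ode_solution_def
proof (intro ballI conjI allI impI)
  fix t i
  assume i: "i < m"
  have mv: "(shift_mat m *\<^sub>v shift_solution m t) $ i = (if i = 0 then 0 else t ^ i / fact i)"
  proof -
    have "(shift_mat m *\<^sub>v shift_solution m t) $ i
        = (\<Sum>j<m. (if i = Suc j then 1 else 0) * (t ^ Suc j / fact (Suc j)))"
      using i by (auto simp: scalar_prod_def shift_mat_def shift_solution_def lessThan_atLeast0
          simp del: fact_Suc power_Suc intro!: sum.cong)
    also have "\<dots> = (\<Sum>j<m. if j = i - 1 then (if i = 0 then 0 else t ^ i / fact i) else 0)"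
      by (intro sum.cong) (auto simp del: fact_Suc power_Suc)
    also have "\<dots> = (if i = 0 then 0 else t ^ i / fact i)"
      using i by auto
    finally show ?thesis .
  qed
  have "((\<lambda>\<tau>. \<tau> ^ Suc i / fact (Suc i)) has_real_derivative
      (real (Suc i) * t ^ i) / fact (Suc i)) (at t within {t0..T})"
    by (auto intro!: derivative_eq_intros simp del: fact_Suc power_Suc of_nat_Suc)
  moreover have "(real (Suc i) * t ^ i) / fact (Suc i) = t ^ i / fact i"
    by (simp add: fact_Suc del: of_nat_Suc)
  ultimately have "((\<lambda>\<tau>. shift_solution m \<tau> $ i) has_real_derivative t ^ i / fact i)
      (at t within {t0..T})"
    using i by (simp add: shift_solution_def del: fact_Suc power_Suc)
  moreover have "(shift_mat m *\<^sub>v shift_solution m t + unit_vec m 0) $ i = t ^ i / fact i"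
    using i mv by auto
  ultimately show "((\<lambda>\<tau>. shift_solution m \<tau> $ i) has_real_derivative
      (shift_mat m *\<^sub>v shift_solution m t + unit_vec m 0) $ i) (at t within {t0..T})"
    by simp
qed (simp add: shift_solution_def)

lemma eerk_step_shift:
  assumes "i < m"
  shows "eerk_step s c a b (shift_mat m) (\<lambda>t u. unit_vec m 0) k t (0\<^sub>v m) $ i
       = (\<Sum>j=1..s. (deriv ^^ i) (b j) 0) / fact i * k ^ Suc i"
proof -
  have dims: "mat_fun f (k \<cdot>\<^sub>m shift_mat m) \<in> carrier_mat m m" for f
    by (simp add: mat_fun_def)
  have zero: "(mat_fun exp (k \<cdot>\<^sub>m shift_mat m) *\<^sub>v 0\<^sub>v m) $ i = 0"
    using assms dims[of exp] by (auto simp: scalar_prod_def)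
  have col: "(mat_fun (b j) (k \<cdot>\<^sub>m shift_mat m) *\<^sub>v unit_vec m 0) $ i
      = (deriv ^^ i) (b j) 0 / fact i * k ^ i" for j
    using assms dims[of "b j"] mat_fun_smult_shift_mat[OF assms, of "b j" k]
    by (simp add: scalar_prod_right_unit row_def)
  show ?thesis
    unfolding eerk_step_def using assms
    by (simp add: zero col sum_distrib_left sum_distrib_right sum_divide_distrib mult_ac)
qed

section \<open>From order to Taylor coefficients\<close>

lemma monomial_bigo_higher_power_imp_zero:
  fixes C :: real
  assumes "(\<lambda>k::real. C * k ^ n) \<in> O[at_right 0](\<lambda>k. k ^ N)" and "n < N"
  shows "C = 0"
proof -
  obtain D where "\<forall>\<^sub>F k in at_right 0. norm (C * k ^ n) \<le> D * norm (k ^ N)"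
    using assms(1) by (auto simp: bigo_def)
  then have bound: "\<forall>\<^sub>F k::real in at_right 0. \<bar>C\<bar> \<le> D * k ^ (N - n)"
    using eventually_at_right_less[of "0::real"]
  proof eventually_elim
    case (elim k)
    have "k ^ N = k ^ n * k ^ (N - n)"
      using assms(2) by (simp add: power_add[symmetric])
    then have "k ^ n * \<bar>C\<bar> \<le> k ^ n * (D * k ^ (N - n))"
      using elim by (simp add: abs_mult mult_ac)
    then show ?case
      using elim by simp
  qed
  have "((\<lambda>k::real. D * k ^ (N - n)) \<longlongrightarrow> D * 0 ^ (N - n)) (at_right 0)"
    by (intro tendsto_intros)
  then have "\<bar>C\<bar> \<le> D * 0 ^ (N - n)"
    using bound by (rule tendsto_lowerbound) simp
  then show ?thesis
    using assms(2) by (simp add: power_0_left)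
qed

text \<open>For \<open>r < q\<close> the test problem of dimension \<open>q\<close> detects the Taylor coefficient of degree \<open>r\<close>:
  component \<open>r\<close> of the error is a pure multiple of \<open>k\<^bsup>r+1\<^esup>\<close>, too large for order \<open>q\<close> unless the
  factor is \<open>0\<close>. The right-hand side is the derivative of \<open>\<phi>\<^sub>1\<close> of order \<open>r\<close> at \<open>0\<close>.\<close>

lemma order_imp_taylor_coeff:
  assumes order: "classical_order_at_least q s c a b" and "r < q"
  shows "(\<Sum>i=1..s. (deriv ^^ r) (b i) 0) = 1 / real (Suc r)"
proof -
  let ?S = "\<Sum>i=1..s. (deriv ^^ r) (b i) 0"
  let ?err = "\<lambda>k. shift_solution q (0 + k)
    - eerk_step s c a b (shift_mat q) (\<lambda>t u. unit_vec q 0) k 0 (shift_solution q 0)"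
  obtain d where d: "\<forall>m B F t0 T U.
      B \<in> carrier_mat m m \<and> smooth_rhs d m F \<and> t0 < T \<and> ode_solution m B F t0 T U \<longrightarrow>
      (\<forall>i<m. (\<lambda>k. (U (t0 + k) - eerk_step s c a b B F k t0 (U t0)) $ i)
               \<in> O[at_right 0](\<lambda>k. k ^ (q + 1)))"
    using order unfolding classical_order_at_least_def by (elim exE)
  have "smooth_rhs d q (\<lambda>t u. unit_vec q 0)"
    by (simp add: smooth_rhs_const)
  then have "shift_mat q \<in> carrier_mat q q \<and> smooth_rhs d q (\<lambda>t u. unit_vec q 0) \<and> 0 < (1 :: real)
      \<and> ode_solution q (shift_mat q) (\<lambda>t u. unit_vec q 0) 0 1 (shift_solution q)"
    by (simp add: ode_solution_shift)
  from d[THEN spec, THEN spec, THEN spec, THEN spec, THEN spec, THEN spec, THEN mp, OF this]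
  have "\<forall>i<q. (\<lambda>k. ?err k $ i) \<in> O[at_right 0](\<lambda>k. k ^ (q + 1))" .
  then have "(\<lambda>k. ?err k $ r) \<in> O[at_right 0](\<lambda>k. k ^ (q + 1))"
    using \<open>r < q\<close> by blast
  moreover have "?err k $ r = (1 / fact (Suc r) - ?S / fact r) * k ^ Suc r" for k
  proof -
    have "dim_vec (eerk_step s c a b (shift_mat q) (\<lambda>t u. unit_vec q 0) k 0 (0\<^sub>v q)) = q"
      by (simp add: eerk_step_def)
    then have "?err k $ r = k ^ Suc r / fact (Suc r) - ?S / fact r * k ^ Suc r"
      using \<open>r < q\<close> eerk_step_shift[OF \<open>r < q\<close>, of s c a b k 0]
      by (simp add: shift_solution_zero del: fact_Suc power_Suc) (simp add: shift_solution_def)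
    then show ?thesis
      by (simp add: left_diff_distrib)
  qed
  ultimately have "(\<lambda>k. (1 / fact (Suc r) - ?S / fact r) * k ^ Suc r)
      \<in> O[at_right 0](\<lambda>k. k ^ (q + 1))"
    by simp
  then have "1 / fact (Suc r) - ?S / fact r = 0"
    by (rule monomial_bigo_higher_power_imp_zero) (use \<open>r < q\<close> in simp)
  then show ?thesis
    by (simp add: field_simps del: of_nat_Suc)
qed

theorem theorem7:
  fixes q s :: nat
    and c :: "nat \<Rightarrow> real"
    and lam :: "nat \<Rightarrow> nat \<Rightarrow> nat \<Rightarrow> real"
    and mu :: "nat \<Rightarrow> nat \<Rightarrow> real"
  assumes "q \<in> {1, 2, 3, 4}" and "s \<ge> 1"
    and explicit: "\<And>i j l. i \<in> {1..s} \<Longrightarrow> j \<in> {1..s} \<Longrightarrow> l \<in> {1..s} \<Longrightarrow> j \<ge> i \<Longrightarrow> lam i j l = 0"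
    and row_sum: "\<And>i. i \<in> {1..s} \<Longrightarrow> (\<Sum>j=1..s. coeff_a s c lam i j 0) = c i"
    and order: "classical_order_at_least q s c (coeff_a s c lam) (coeff_b s mu)"
    and "s \<le> q"
  shows "(\<Sum>i=1..s. mu i 1) = 1 \<and> (\<forall>l\<in>{2..s}. (\<Sum>i=1..s. mu i l) = 0)"
proof -
  define M where "M = (\<lambda>l. \<Sum>i=1..s. mu i l)"
  define P where "P = weight_poly s M"
  have "P - 1 = 0"
  proof (rule poly_zero_moments_imp_zero)
    show "degree (P - 1) < s"
      unfolding P_def using \<open>s \<ge> 1\<close> by (intro degree_diff_less degree_weight_poly_less) auto
  next
    fix r assume "r < s"
    have "integral {0..1} (\<lambda>x. (1 - x) ^ r * poly (P - 1) x)
        = integral {0..1} (\<lambda>x. (1 - x) ^ r * poly P x - (1 - x) ^ r)"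
      by (simp add: algebra_simps)
    also have "\<dots> = integral {0..1} (\<lambda>x. (1 - x) ^ r * poly P x)
        - integral {0..1} (\<lambda>x. (1 - x) ^ r)"
      by (intro integral_diff integrable_continuous_real continuous_intros)
    also have "integral {0..1} (\<lambda>x. (1 - x) ^ r * poly P x) = 1 / real (Suc r)"
      using order_imp_taylor_coeff[OF order, of r] \<open>r < s\<close> \<open>s \<le> q\<close>
      by (simp add: sum_higher_deriv_coeff_b P_def M_def)
    finally show "integral {0..1} (\<lambda>x. (1 - x) ^ r * poly (P - 1) x) = 0"
      by (simp add: integral_power_one_minus)
  qed
  then have P: "P = 1"
    by simp
  have M: "M l = (if l = 1 then 1 else 0)" if "l \<in> {1..s}" for l
  proof -
    have "M l / fact (l - 1) = coeff 1 (l - 1)"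
      using coeff_weight_poly[OF that, of M] by (simp add: P_def[symmetric] P)
    then show ?thesis
      using that by (auto simp: coeff_1 split: if_splits)
  qed
  show ?thesis
    using \<open>s \<ge> 1\<close> M[of 1] M by (auto simp: M_def)
qed

end
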